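(* Let $D,Q\in\mathbb N$ with $(D,Q)=1$ and $D/Q>1$, and suppose $D/Q$ is not the square of a rational number. Put $D_2=DQ$. Let $m\ge0$ be smallest possible such that $\sqrt{D/Q}=[b_0,\{b_1,\ldots,b_m,2b_0\}]$ with $b_0,\ldots,b_m\in\mathbb N$, and let $n\ge 0$ be smallest possible such that $\sqrt{D_2}=[b'_0,\{b'_1,\ldots,b'_n,2b'_0\}]$ with $b'_0,\ldots,b'_n\in\mathbb N$. Let $r_k/s_k$ be the $k$th convergent of $\sqrt{D/Q}$ and $r'_k/s'_k$ the $k$th convergent of $\sqrt{D_2}$. Then $$r_{l(m+1)-1}=r'_{l(n+1)-1},\qquad s_{l(m+1)-1}=s'_{l(n+1)-1}\,Q$$ for all $l\in\mathbb N$.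
   Context: $\mathbb N=\{1,2,3,\ldots\}$ and $(a,b)$ denotes the greatest common divisor. The notation $[b_0,\{b_1,\ldots,b_m,2b_0\}]$ denotes the infinite simple continued fraction with initial term $b_0$ followed by the block $b_1,\ldots,b_m,2b_0$ (of length $m+1$) repeated periodically forever; both $\sqrt{D/Q}$ and $\sqrt{D_2}$ have expansions of this form. Convergents $r_k/s_k=[b_0,b_1,\ldots,b_k]$ (and likewise $r'_k/s'_k=[b'_0,\ldots,b'_k]$) are indexed from $k=0$ and written in lowest terms with positive integer numerators and denominators. *)

theory Defs
  imports Complex_Main
begin

text \<open>The finite simple continued fraction $[a_0, a_1, \ldots, a_k]$. The value on the empty
  list is a dummy and never arises below.\<close>

fun cf_fin :: "nat list \<Rightarrow> rat" where
  "cf_fin [] = 0"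
| "cf_fin [a] = of_nat a"
| "cf_fin (a # b # xs) = of_nat a + 1 / cf_fin (b # xs)"

definition cf_conv :: "(nat \<Rightarrow> nat) \<Rightarrow> nat \<Rightarrow> rat" where
  "cf_conv a k = cf_fin (map a [0..<Suc k])"

text \<open>\<^term>\<open>quotient_of\<close> yields coprime components with positive denominator.\<close>

definition cf_num :: "(nat \<Rightarrow> nat) \<Rightarrow> nat \<Rightarrow> int" where
  "cf_num a k = fst (quotient_of (cf_conv a k))"

definition cf_den :: "(nat \<Rightarrow> nat) \<Rightarrow> nat \<Rightarrow> int" where
  "cf_den a k = snd (quotient_of (cf_conv a k))"

definition has_cf :: "real \<Rightarrow> (nat \<Rightarrow> nat) \<Rightarrow> bool" where
  "has_cf x a \<longleftrightarrow> (\<lambda>k. real_of_rat (cf_conv a k)) \<longlonglongrightarrow> x"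

text \<open>The sequence $b_0, b_1, \ldots, b_m, 2 b_0, b_1, \ldots, b_m, 2 b_0, \ldots$ of partial
  quotients of $[b_0, \{b_1, \ldots, b_m, 2 b_0\}]$. Only the values of \<open>b\<close> on \<open>{0..m}\<close> are used;
  for \<open>m = 0\<close> the repeated block is $2 b_0$ alone.\<close>

definition per_seq :: "nat \<Rightarrow> (nat \<Rightarrow> nat) \<Rightarrow> nat \<Rightarrow> nat" where
  "per_seq m b k =
     (if k = 0 then b 0
      else if k mod (m + 1) = 0 then 2 * b 0
      else b (k mod (m + 1)))"

definition per_expansion :: "real \<Rightarrow> nat \<Rightarrow> (nat \<Rightarrow> nat) \<Rightarrow> bool" where
  "per_expansion x m b \<longleftrightarrow> (\<forall>i\<le>m. b i \<ge> 1) \<and> has_cf x (per_seq m b)"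

definition min_per_expansion :: "real \<Rightarrow> nat \<Rightarrow> (nat \<Rightarrow> nat) \<Rightarrow> bool" where
  "min_per_expansion x m b \<longleftrightarrow>
     per_expansion x m b \<and> (\<forall>m' b'. per_expansion x m' b' \<longrightarrow> m \<le> m')"

end

theory Submission
  imports Defs
begin

text \<open>Put $x = \sqrt{D/Q}$. If $r/s$ is the convergent at the end of a period of $x$, then the next
  complete quotient is $b_0 + x$, and comparing rational and irrational parts shows that $sD/Q$ is an
  integer and $r^2 - (D/Q) s^2 = \pm 1$; since $D$ and $Q$ are coprime, $s = Qt$ with
  $r^2 - DQt^2 = \pm 1$. Conversely, every positive solution of this Pell equation arises in this
  way: the matrix with rows $(r, tD - r b_0)$ and $(Qt, r - Qt b_0)$ is unimodular and maps
  $b_0 + x$ to $x$, so it is a product of continued fraction steps, and the minimality of the period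
  puts its last step at the end of a period. The same applies to $\sqrt{DQ}$ (take $DQ$ and $1$ for
  $D$ and $Q$) with the same Pell equation. Both sequences of numerators are therefore the
  increasing enumeration of the first components $r$ of the solutions, and $r$ determines $t$.\<close>

section \<open>Convergents and their matrices\<close>

text \<open>All three conditions pass to the tail and the complete quotient, so they serve together
  as an induction invariant.\<close>

definition irrational_cf :: "real \<Rightarrow> (nat \<Rightarrow> nat) \<Rightarrow> bool" where
  "irrational_cf x a \<longleftrightarrow> has_cf x a \<and> (\<forall>i. a i \<ge> 1) \<and> x \<notin> \<rat>"

text \<open>\<open>cf_matrix a k p q u v\<close> says that the matrix with rows \<open>(p, q)\<close> and \<open>(u, v)\<close> is the product
  of the matrices with rows \<open>(a i, 1)\<close> and \<open>(1, 0)\<close> for \<open>i = 0, \<dots>, k\<close>, that is, \<open>p / u\<close> and \<open>q / v\<close>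
  are the \<open>k\<close>-th and the \<open>(k - 1)\<close>-th convergent.\<close>

inductive cf_matrix :: "(nat \<Rightarrow> nat) \<Rightarrow> nat \<Rightarrow> int \<Rightarrow> int \<Rightarrow> int \<Rightarrow> int \<Rightarrow> bool" where
  base: "cf_matrix a 0 (int (a 0)) 1 1 0"
| step: "cf_matrix (\<lambda>i. a (Suc i)) k p q u v \<Longrightarrow>
    cf_matrix a (Suc k) (int (a 0) * p + u) (int (a 0) * q + v) p q"

lemma cf_matrix_exists: "\<exists>p q u v. cf_matrix a k p q u v"
proof (induction k arbitrary: a)
  case 0
  show ?case using cf_matrix.base by blast
next
  case (Suc k)
  then show ?case using cf_matrix.step by meson
qed

lemma cf_matrix_det: "cf_matrix a k p q u v \<Longrightarrow> \<bar>p * v - q * u\<bar> = 1"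
proof (induction rule: cf_matrix.induct)
  case (step a k p q u v)
  have "(int (a 0) * p + u) * q - (int (a 0) * q + v) * p = - (p * v - q * u)"
    by (simp add: algebra_simps)
  then show ?case using step by simp
qed simp

lemma cf_matrix_pos:
  "cf_matrix a k p q u v \<Longrightarrow> (\<And>i. a i \<ge> 1) \<Longrightarrow> 0 < p \<and> 0 < q \<and> 0 < u \<and> 0 \<le> v"
proof (induction rule: cf_matrix.induct)
  case (base a)
  then show ?case by (simp add: Suc_le_eq)
next
  case (step a k p q u v)
  have "0 < p \<and> 0 < q \<and> 0 < u \<and> 0 \<le> v" using step by blast
  moreover have "int (a 0) > 0" using step.prems[of 0] by simp
  ultimately show ?case by (simp add: add_pos_pos add_pos_nonneg)
qed

lemma cf_conv_0: "cf_conv a 0 = of_nat (a 0)"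
  by (simp add: cf_conv_def)

lemma cf_conv_Suc: "cf_conv a (Suc k) = of_nat (a 0) + 1 / cf_conv (\<lambda>i. a (Suc i)) k"
proof -
  have shift: "map a [Suc 0..<Suc n] = map (\<lambda>i. a (Suc i)) [0..<n]" for n
    by (metis (no_types, lifting) comp_apply ext map_Suc_upt map_map)
  have "map a [0..<Suc (Suc k)] = a 0 # map a [Suc 0..<Suc (Suc k)]"
    by (subst upt_conv_Cons) auto
  also have "\<dots> = a 0 # map (\<lambda>i. a (Suc i)) [0..<Suc k]"
    by (subst shift) (rule refl)
  \<comment> \<open>The third clause of \<open>cf_fin\<close> needs two explicit leading
    entries.\<close>
  also have "\<dots> = a 0 # a (Suc 0) # map (\<lambda>i. a (Suc i)) [Suc 0..<Suc k]"
    by (subst upt_conv_Cons) auto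
  finally show ?thesis
    unfolding cf_conv_def by (subst (2) upt_conv_Cons) auto
qed

lemma cf_conv_matrix:
  "cf_matrix a k p q u v \<Longrightarrow> (\<And>i. a i \<ge> 1) \<Longrightarrow> cf_conv a k = of_int p / of_int u"
proof (induction rule: cf_matrix.induct)
  case (base a)
  then show ?case by (simp add: cf_conv_0)
next
  case (step a k p q u v)
  have "0 < p" "0 < u" using cf_matrix_pos[OF step.hyps] step.prems by blast+
  moreover have "cf_conv (\<lambda>i. a (Suc i)) k = of_int p / of_int u" using step by blast
  ultimately show ?case by (simp add: cf_conv_Suc add_divide_distrib)
qed

text \<open>Determinant 1 or -1 makes \<open>p\<close> and \<open>u\<close> coprime, so
  \<open>quotient_of\<close> returns exactly this pair.\<close>

lemma cf_matrix_num_den: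
  assumes "cf_matrix a k p q u v" "\<And>i. a i \<ge> 1"
  shows "cf_num a k = p" "cf_den a k = u"
proof -
  have u: "0 < u" using cf_matrix_pos assms by blast
  have "coprime p u"
  proof (rule coprimeI)
    fix c assume "c dvd p" "c dvd u"
    then have "c dvd p * v - q * u" by simp
    then show "is_unit c" using cf_matrix_det[OF assms(1)] by (metis dvd_abs_iff)
  qed
  then have "quotient_of (cf_conv a k) = (p, u)"
    using cf_conv_matrix[OF assms] u
    by (simp add: Fract_of_int_quotient[symmetric] quotient_of_Fract normalize_stable)
  then show "cf_num a k = p" "cf_den a k = u" by (simp_all add: cf_num_def cf_den_def)
qed

text \<open>Peeling off the first partial quotient expresses a numerator through a numerator and a
  denominator of the tail, so both claims are proved together. Denominators grow only weakly: the
  first two are both 1 when \<open>a 1 = 1\<close>.\<close>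

lemma cf_num_den_mono:
  assumes "\<And>i. a i \<ge> 1"
  shows "cf_num a k < cf_num a (Suc k) \<and> cf_den a k \<le> cf_den a (Suc k)"
  using assms
proof (induction k arbitrary: a)
  case 0
  have "cf_matrix a (Suc 0) (int (a 0) * int (a 1) + 1) (int (a 0) * 1 + 0) (int (a 1)) 1"
    using cf_matrix.step[OF cf_matrix.base[of "\<lambda>i. a (Suc i)"]] by simp
  note cf_matrix_num_den[OF this 0] cf_matrix_num_den[OF cf_matrix.base 0]
  moreover have "int (a 0) * 1 \<le> int (a 0) * int (a 1)"
    using 0[of 1] by (intro mult_left_mono) auto
  ultimately show ?case using 0[of 1] by simp
next
  case (Suc k)
  let ?a = "\<lambda>i. a (Suc i)"
  have rec: "cf_num a (Suc j) = int (a 0) * cf_num ?a j + cf_den ?a j"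
            "cf_den a (Suc j) = cf_num ?a j" for j
  proof -
    obtain p q u v where M: "cf_matrix ?a j p q u v" using cf_matrix_exists by blast
    show "cf_num a (Suc j) = int (a 0) * cf_num ?a j + cf_den ?a j"
      "cf_den a (Suc j) = cf_num ?a j"
      using cf_matrix_num_den[OF M Suc.prems] cf_matrix_num_den[OF cf_matrix.step[OF M] Suc.prems]
      by simp_all
  qed
  have IH: "cf_num ?a k < cf_num ?a (Suc k)" "cf_den ?a k \<le> cf_den ?a (Suc k)"
    using Suc.IH[of ?a, OF Suc.prems] by (rule conjunct1, rule conjunct2)
  have "int (a 0) * cf_num ?a k < int (a 0) * cf_num ?a (Suc k)"
    using IH(1) Suc.prems[of 0] by (intro mult_strict_left_mono) auto
  then show ?case using IH unfolding rec by linarith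
qed

section \<open>Expansions of irrational numbers\<close>

lemma has_cf_limit_ge:
  assumes "has_cf x a"
  shows "real (a 0) \<le> x"
proof (rule LIMSEQ_le_const)
  show "(\<lambda>k. real_of_rat (cf_conv a k)) \<longlonglongrightarrow> x" using assms by (simp add: has_cf_def)
  \<comment> \<open>Valid for every sequence, since a vanishing tail contributes
    \<open>1 / 0 = 0\<close>.\<close>
  have nonneg: "0 \<le> cf_conv b k" for b k
    by (induction k arbitrary: b) (auto simp: cf_conv_0 cf_conv_Suc)
  have "of_nat (a 0) \<le> cf_conv a k" for k
    using nonneg by (cases k) (auto simp: cf_conv_0 cf_conv_Suc)
  then show "\<exists>N. \<forall>n\<ge>N. real (a 0) \<le> real_of_rat (cf_conv a n)"
    by (metis of_rat_less_eq of_rat_of_nat_eq)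
qed

text \<open>The map t -> 1 / (t - \<open>a 0\<close>) is continuous at the irrational
  \<open>x\<close> and sends the convergents of \<open>a\<close> from index 1 on to those of the
  tail. The new limit is at least \<open>a 1\<close>, hence at least 1, and irrational, hence
  greater than 1.\<close>

lemma irrational_cf_Suc:
  assumes "irrational_cf x a"
  shows "irrational_cf (1 / (x - real (a 0))) (\<lambda>i. a (Suc i))"
    and "real (a 0) < x" and "1 < 1 / (x - real (a 0))" and "x < real (a 0) + 1"
proof -
  let ?y = "1 / (x - real (a 0))" and ?a = "\<lambda>i. a (Suc i)"
  have irr: "x \<notin> \<rat>" and cf: "has_cf x a" and pos: "\<And>i. a i \<ge> 1"
    using assms by (auto simp: irrational_cf_def)
  have ne: "x \<noteq> real (a 0)" using irr by auto
  then show gt: "real (a 0) < x" using has_cf_limit_ge[OF cf] by simp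
  have "(\<lambda>k. real_of_rat (cf_conv a (Suc k))) \<longlonglongrightarrow> x"
    using cf unfolding has_cf_def by (rule LIMSEQ_Suc)
  then have "(\<lambda>k. 1 / (real_of_rat (cf_conv a (Suc k)) - real (a 0))) \<longlonglongrightarrow> ?y"
    using ne by (intro tendsto_intros) auto
  moreover have "1 / (real_of_rat (cf_conv a (Suc k)) - real (a 0)) = real_of_rat (cf_conv ?a k)"
    for k
    by (simp add: cf_conv_Suc of_rat_add of_rat_divide)
  ultimately have cf': "has_cf ?y ?a" by (simp add: has_cf_def)
  have "?y \<notin> \<rat>"
  proof
    assume "?y \<in> \<rat>"
    then have "inverse ?y + real (a 0) \<in> \<rat>" by (rule Rats_add[OF Rats_inverse Rats_of_nat])
    then show False using irr by simp
  qed
  with cf' pos show "irrational_cf ?y ?a" by (simp add: irrational_cf_def)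
  have "1 \<le> ?y" using has_cf_limit_ge[OF cf'] pos[of "Suc 0"] by simp
  moreover have "?y \<noteq> 1" using \<open>?y \<notin> \<rat>\<close> by (metis Rats_1)
  ultimately show "1 < ?y" by linarith
  then show "x < real (a 0) + 1" using gt by (simp add: field_simps)
qed

lemma irrational_cf_head: "irrational_cf x a \<Longrightarrow> real c \<le> x \<Longrightarrow> x < real c + 1 \<Longrightarrow> a 0 = c"
  using irrational_cf_Suc(2,4)[of x a] by linarith

lemma irrational_cf_unique:
  assumes "irrational_cf x a" "irrational_cf x b"
  shows "a = b"
proof
  fix k
  show "a k = b k"
    using assms
  proof (induction k arbitrary: x a b)
    case 0
    show ?case using irrational_cf_head irrational_cf_Suc(2,4)[OF 0(2)] 0(1) by (meson less_imp_le)
  next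
    case (Suc k)
    have "a 0 = b 0"
      using irrational_cf_head irrational_cf_Suc(2,4)[OF Suc.prems(2)] Suc.prems(1)
      by (meson less_imp_le)
    then show ?case using Suc.IH irrational_cf_Suc(1) Suc.prems by metis
  qed
qed

text \<open>Adding an integer alters only the first partial quotient. For \<open>c = a 0\<close> the
  new head is \<open>2 * a 0\<close>, the entry that closes a period.\<close>

lemma irrational_cf_add:
  assumes "irrational_cf x a"
  shows "irrational_cf (real c + x) (a(0 := c + a 0))"
proof -
  have "cf_conv (a(0 := c + a 0)) k = of_nat c + cf_conv a k" for k
    by (cases k) (auto simp: cf_conv_0 cf_conv_Suc)
  then have "has_cf (real c + x) (a(0 := c + a 0))"
    using assms by (auto simp: has_cf_def irrational_cf_def of_rat_add intro!: tendsto_intros)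
  moreover have "real c + x \<notin> \<rat>"
  proof
    assume "real c + x \<in> \<rat>"
    then have "(real c + x) - real c \<in> \<rat>" by (intro Rats_diff) auto
    then show False using assms by (simp add: irrational_cf_def)
  qed
  moreover have "(a(0 := c + a 0)) i \<ge> 1" for i
    using assms by (simp add: irrational_cf_def trans_le_add2)
  ultimately show ?thesis by (simp add: irrational_cf_def)
qed

section \<open>Complete quotients and unimodular matrices\<close>

text \<open>\<open>X\<close> is the complete quotient left after \<open>Suc k\<close> steps. The
  identity is x = (p X + q) / (u X + v), the composite of the maps t -> a i + 1 / t, with the
  denominator cleared.\<close>

lemma cf_matrix_complete_quotient:
  assumes "cf_matrix a k p q u v" "irrational_cf x a"
  shows "\<exists>X. irrational_cf X (\<lambda>i. a (i + Suc k)) \<and> 1 < X \<and>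
    x * (real_of_int u * X + real_of_int v) = real_of_int p * X + real_of_int q"
  using assms
proof (induction arbitrary: x rule: cf_matrix.induct)
  case (base a)
  let ?X = "1 / (x - real (a 0))"
  note f = irrational_cf_Suc[OF base]
  have "x * ?X = real (a 0) * ?X + 1" using f(2) by (simp add: field_simps)
  then show ?case using f by (intro exI[of _ ?X]) simp
next
  case (step a k p q u v)
  let ?x = "1 / (x - real (a 0))"
  note f = irrational_cf_Suc[OF step.prems]
  obtain X where X: "irrational_cf X (\<lambda>i. a (Suc (i + Suc k)))" "1 < X"
    "?x * (real_of_int u * X + real_of_int v) = real_of_int p * X + real_of_int q"
    using step.IH[OF f(1)] by blast
  have "real_of_int u * X + real_of_int v
      = (x - real (a 0)) * (real_of_int p * X + real_of_int q)"
    unfolding X(3)[symmetric] using f(2) by simp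
  then show ?case using X(1,2) by (intro exI[of _ X]) (simp add: algebra_simps)
qed

text \<open>The usual criterion assumes \<open>0 < v < u\<close>; the other two alternatives are the shapes in which the
  Euclidean descent can end, and they exclude the sign of the determinant for which the expansion of
  \<open>p / u\<close> would have the wrong parity.\<close>

lemma unimodular_imp_cf_matrix:
  fixes p q u v :: int
  assumes "irrational_cf x a" "1 < X"
    and "x * (of_int u * X + of_int v) = of_int p * X + of_int q"
    and "\<bar>p * v - q * u\<bar> = 1"
    and "0 < v \<and> v < u \<or> v = 0 \<and> u = 1 \<and> q = 1 \<or> v = 1 \<and> u = 1 \<and> p - q = 1"
    and "0 < p"
  shows "\<exists>k. cf_matrix a k p q u v \<and> irrational_cf X (\<lambda>i. a (i + Suc k))"
  using assms
proof (induction "nat u" arbitrary: x a p q u v rule: less_induct)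
  case less
  note cf = less.prems(1) and X = less.prems(2) and eq = less.prems(3) and det = less.prems(4)
  note f = irrational_cf_Suc[OF cf]
  let ?x = "1 / (x - real (a 0))" and ?a = "\<lambda>i. a (Suc i)"
  have head: "int (a 0) = c" if "of_int c \<le> x" "x < of_int c + 1" for c
    using that f(2,4) by linarith
  from less.prems(5) consider
    (gen) "0 < v" "v < u" | (zero) "v = 0" "u = 1" "q = 1" | (one) "v = 1" "u = 1" "p - q = 1"
    by blast
  then show ?case
  proof cases
    case zero
    have x: "x = of_int p + 1 / X" using eq X zero by (simp add: field_simps)
    have a0: "int (a 0) = p" using X by (intro head) (simp_all add: x)
    then have "real (a 0) = of_int p" by (metis of_int_of_nat_eq)
    then have "?x = X" using x by simp
    then have "irrational_cf X (\<lambda>i. a (i + Suc 0))" using f(1) by simp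
    moreover have "cf_matrix a 0 p q u v" using cf_matrix.base[of a] a0 zero by simp
    ultimately show ?thesis by blast
  next
    case one
    \<comment> \<open>The matrix with rows (q + 1, q) and (1, 1) is the product of two steps, with
      partial quotients q and 1.\<close>
    have x: "x = of_int q + X / (X + 1)"
    proof -
      have "p = q + 1" using one by simp
      then show ?thesis using eq X one by (simp add: field_simps)
    qed
    have a0: "int (a 0) = q" using X by (intro head) (simp_all add: x field_simps)
    then have "real (a 0) = of_int q" by (metis of_int_of_nat_eq)
    then have "?x = (X + 1) / X" using x by simp
    then have x1: "?x = 1 + 1 / X" using X by (simp add: add_divide_distrib)
    have "a (Suc 0) = 1"
      using irrational_cf_head[OF f(1), of 1] X unfolding x1 by simp
    moreover have "irrational_cf X (\<lambda>i. a (i + Suc 1))"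
      using irrational_cf_Suc(1)[OF f(1)] calculation unfolding x1 by simp
    moreover have "cf_matrix a (Suc 0) (int (a 0) * int (a (Suc 0)) + 1)
        (int (a 0) * 1 + 0) (int (a (Suc 0))) 1"
      by (rule cf_matrix.step[OF cf_matrix.base[of ?a]])
    moreover have "p = q + 1" using one by simp
    ultimately have "cf_matrix a 1 p q u v" using a0 one(1,2) by simp
    then show ?thesis using \<open>irrational_cf X (\<lambda>i. a (i + Suc 1))\<close> by blast
  next
    case gen
    \<comment> \<open>One Euclidean step: subtracting c times the second row from the first leaves
      the matrix with rows (u, v) and (p', q'), whose lower left entry p' is smaller than u.\<close>
    define c p' q' where "c = p div u" and "p' = p mod u" and "q' = q - c * v"
    have p: "p = c * u + p'" and q: "q = c * v + q'" by (simp_all add: c_def p'_def q'_def)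
    have p': "0 \<le> p'" "p' < u" using gen by (simp_all add: p'_def)
    have det': "\<bar>p' * v - q' * u\<bar> = 1" using det unfolding p q by (simp add: algebra_simps)
    have "p' \<noteq> 0"
    proof
      assume "p' = 0"
      then have "u dvd 1" using det'
        by (metis dvd_abs_iff dvd_minus_iff dvd_triv_right mult_zero_left diff_0)
      then show False using gen by simp
    qed
    with p' have p'pos: "0 < p'" by simp
    have v1: "1 \<le> p' * v" using p'pos gen by (simp add: int_one_le_iff_zero_less)
    have q'nonneg: "0 \<le> q'"
    proof (rule ccontr)
      assume "\<not> 0 \<le> q'"
      then have "(-q') * u \<ge> 1 * u" using gen by (intro mult_right_mono) auto
      then show False using det' v1 gen by simp
    qed
    \<comment> \<open>Both bounds come from q' u \<le> p' v + 1, estimating once v and once p' by u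
      - 1.\<close>
    have q'le: "q' \<le> p'" "q' \<le> v"
    proof -
      have qu: "q' * u \<le> p' * v + 1" using det' by linarith
      have "p' * v \<le> p' * (u - 1)" using p'pos gen by (intro mult_left_mono) auto
      then have "q' * u < (p' + 1) * u" using qu p'pos gen by (simp add: algebra_simps)
      then show "q' \<le> p'" using gen by simp
      have "p' * v \<le> (u - 1) * v" using p' gen by (intro mult_right_mono) auto
      then have "q' * u < (v + 1) * u" using qu gen by (simp add: algebra_simps)
      then show "q' \<le> v" using gen by simp
    qed
    \<comment> \<open>The quotient num / den turns out to be the fractional part of x, so that c,
      obtained from p and u alone, is the floor of x and equals \<open>a 0\<close>.\<close>
    define den num where "den = of_int u * X + of_int v" and "num = of_int p' * X + of_int q'"
    have den: "0 < den" unfolding den_def using gen X by (simp add: add_pos_pos)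
    have num: "0 < num" unfolding num_def using p'pos q'nonneg X by (simp add: add_pos_nonneg)
    have "real_of_int p' * X < of_int u * X" using p' X by simp
    then have lt: "num < den" unfolding num_def den_def using q'le by simp
    have xden: "x * den = of_int c * den + num"
      using eq unfolding den_def num_def p q by (simp add: algebra_simps)
    then have x: "x = of_int c + num / den" using den by (simp add: field_simps)
    have a0: "int (a 0) = c" using den num lt by (intro head) (simp_all add: x)
    then have "real (a 0) = of_int c" by (metis of_int_of_nat_eq)
    then have x1: "?x = den / num" using x by simp
    have eq': "?x * (of_int p' * X + of_int q') = of_int u * X + of_int v"
      unfolding x1 using num by (simp flip: num_def den_def)
    \<comment> \<open>In the boundary cases q' = 0 and q' = p' the determinant is, up to sign, a
      product of positive integers; both factors are 1, which gives the two terminal shapes.\<close>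
    have inv': "0 < q' \<and> q' < p' \<or> q' = 0 \<and> p' = 1 \<and> v = 1 \<or> q' = 1 \<and> p' = 1 \<and> u - v = 1"
    proof -
      consider "q' = 0" | "q' = p'" | "0 < q'" "q' < p'" using q'nonneg q'le by linarith
      then show ?thesis
      proof cases
        case 1
        then have "p' * v = 1" using det' v1 by simp
        then show ?thesis using 1 p'pos gen by (simp add: pos_zmult_eq_1_iff)
      next
        case 2
        then have "\<bar>p' * (u - v)\<bar> = 1" using det' by (simp add: algebra_simps abs_minus_commute)
        then have "p' * (u - v) = 1" using p'pos gen by simp
        then show ?thesis using 2 p'pos gen by (simp add: pos_zmult_eq_1_iff)
      qed simp
    qed
    have det'': "\<bar>u * q' - v * p'\<bar> = 1"
      using det' by (simp add: algebra_simps abs_minus_commute)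
    have "nat p' < nat u" "0 < u" using p' gen by simp_all
    then obtain k where k: "cf_matrix ?a k u v p' q'" "irrational_cf X (\<lambda>i. ?a (i + Suc k))"
      using less.hyps[OF _ f(1) X eq' det'' inv'] by blast
    have "cf_matrix a (Suc k) p q u v" using cf_matrix.step[OF k(1)] unfolding a0 p q .
    moreover have "irrational_cf X (\<lambda>i. a (i + Suc (Suc k)))" using k(2) by simp
    ultimately show ?thesis by blast
  qed
qed

section \<open>Periods of partial quotients and the norm equation\<close>

text \<open>Residues mod m + 1 are unchanged; only index 0 is exceptional, where
  \<open>per_seq\<close> has \<open>b 0\<close> in place of \<open>2 * b 0\<close>.\<close>

lemma per_seq_shift:
  assumes "1 \<le> l"
  shows "(\<lambda>i. per_seq m b (i + l * (m + 1))) = (per_seq m b)(0 := 2 * b 0)"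
proof
  fix i
  have "(i + l * (m + 1)) mod (m + 1) = i mod (m + 1)" by (rule mod_mult_self1)
  moreover have "i + l * (m + 1) \<noteq> 0" using assms by simp
  ultimately show "per_seq m b (i + l * (m + 1)) = ((per_seq m b)(0 := 2 * b 0)) i"
    by (simp only: per_seq_def fun_upd_apply) simp
qed

text \<open>Turns a shift symmetry of \<open>a\<close> into a periodic expansion of block length
  \<open>Suc k\<close>, the form in which minimality can be applied.\<close>

lemma per_seq_eq_self:
  assumes "(\<lambda>i. a (i + Suc k)) = a(0 := 2 * a 0)"
  shows "per_seq k a = a"
proof
  fix i
  show "per_seq k a i = a i"
  proof (induction i rule: less_induct)
    case (less i)
    show ?case
    proof (cases "i \<le> k")
      case True
      then show ?thesis by (auto simp: per_seq_def)
    next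
      case False
      then obtain j where j: "i = j + Suc k" by (metis add.commute le_Suc_ex not_less_eq_eq)
      have "per_seq k a i = ((per_seq k a)(0 := 2 * a 0)) j"
        using fun_cong[OF per_seq_shift[of 1 k a], of j] by (simp add: j)
      also have "\<dots> = (a(0 := 2 * a 0)) j" using less[of j] j by auto
      also have "\<dots> = a i" using fun_cong[OF assms, of j] by (simp add: j)
      finally show ?thesis .
    qed
  qed
qed

text \<open>At a period end the complete quotient is \<open>a 0\<close> + x. Substituting it and
  using that x is irrational with rational square gives v = p - u \<open>a 0\<close> and u x^2 = p
  \<open>a 0\<close> + q; the norm is then the determinant.\<close>

lemma period_end_imp_norm:
  assumes cf: "irrational_cf x a"
    and shift: "(\<lambda>i. a (i + Suc k)) = a(0 := 2 * a 0)"
    and rat: "x\<^sup>2 \<in> \<rat>"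
    and M: "cf_matrix a k p q u v"
  shows "\<exists>w::int. of_int u * x\<^sup>2 = of_int w \<and> \<bar>p\<^sup>2 - w * u\<bar> = 1"
proof -
  obtain X where X: "irrational_cf X (a(0 := 2 * a 0))"
    "x * (real_of_int u * X + real_of_int v) = real_of_int p * X + real_of_int q"
    using cf_matrix_complete_quotient[OF M cf] unfolding shift by blast
  have "irrational_cf (real (a 0) + x) (a(0 := 2 * a 0))"
    using irrational_cf_add[OF cf, of "a 0"] by (simp add: mult_2)
  then have "X = real (a 0) + x"
    using X(1) LIMSEQ_unique unfolding irrational_cf_def has_cf_def by blast
  then have eq: "of_int u * x\<^sup>2 - of_int (p * int (a 0) + q)
      = x * of_int (p - u * int (a 0) - v)"
    using X(2) by (simp add: algebra_simps power2_eq_square)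
  have p: "p - u * int (a 0) - v = 0"
  proof (rule ccontr)
    assume "p - u * int (a 0) - v \<noteq> 0"
    then have "x = (of_int u * x\<^sup>2 - of_int (p * int (a 0) + q)) / of_int (p - u * int (a 0) - v)"
      unfolding eq by (simp del: of_int_diff)
    also have "\<dots> \<in> \<rat>" by (intro Rats_divide Rats_diff Rats_mult Rats_of_int rat)
    finally show False using cf by (simp add: irrational_cf_def)
  qed
  let ?w = "p * int (a 0) + q"
  have "of_int u * x\<^sup>2 = of_int ?w" using eq unfolding p by simp
  moreover have "p\<^sup>2 - ?w * u = p * v - q * u"
  proof -
    have "p * (p - u * int (a 0) - v) = 0" using p by simp
    then show ?thesis by (simp add: algebra_simps power2_eq_square)
  qed
  ultimately show ?thesis using cf_matrix_det[OF M] by metis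
qed

lemma norm_imp_period_end:
  fixes p u w :: int
  assumes cf: "irrational_cf x a"
    and pos: "0 < p" "0 < u"
    and w: "of_int u * x\<^sup>2 = of_int w"
    and norm: "\<bar>p\<^sup>2 - w * u\<bar> = 1"
  shows "\<exists>k q v. cf_matrix a k p q u v \<and> (\<lambda>i. a (i + Suc k)) = a(0 := 2 * a 0)"
proof -
  note f = irrational_cf_Suc[OF cf]
  define c where "c = int (a 0)"
  have c: "1 \<le> c" using cf by (simp add: c_def irrational_cf_def)
  have rc: "real (a 0) = of_int c" by (simp add: c_def)
  have x: "of_int c < x" "x < of_int (c + 1)" using f(2,4) by (simp_all add: c_def)
  \<comment> \<open>These are the values forced at a period end; with them the matrix maps
    \<open>a 0\<close> + x to x.\<close>
  define v q where "v = p - u * c" and "q = w - p * c"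
  have sq: "(of_int c)\<^sup>2 < x\<^sup>2" "x\<^sup>2 < (of_int (c + 1))\<^sup>2"
    using x c by (auto intro!: power_strict_mono)
  have "of_int (u * c\<^sup>2) < (of_int w :: real)" "of_int w < (of_int (u * (c + 1)\<^sup>2) :: real)"
    using sq pos(2) unfolding w[symmetric] by simp_all
  then have wb: "u * c\<^sup>2 < w" "w < u * (c + 1)\<^sup>2" by (simp_all only: of_int_less_iff)
  have "(u * c)\<^sup>2 < w * u" "w * u < (u * (c + 1))\<^sup>2"
    using mult_strict_right_mono[OF wb(1) pos(2)] mult_strict_right_mono[OF wb(2) pos(2)]
    by (simp_all add: power2_eq_square algebra_simps)
  \<comment> \<open>The strict integer bounds on w u leave room for p^2, which differs from w u by
    1.\<close>
  then have "(u * c)\<^sup>2 \<le> p\<^sup>2" "p\<^sup>2 \<le> (u * (c + 1))\<^sup>2" using norm by linarith+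
  then have "u * c \<le> p" "p \<le> u * (c + 1)" using pos c by (auto dest!: power2_le_imp_le)
  then have v: "0 \<le> v" "v \<le> u" by (simp_all add: v_def algebra_simps)
  have det: "p * v - q * u = p\<^sup>2 - w * u" by (simp add: v_def q_def power2_eq_square algebra_simps)
  \<comment> \<open>If v = 0 or v = u, the determinant gives u = 1 and fixes q or p - q up to sign;
    the bounds \<open>wb\<close> select the positive sign.\<close>
  have inv: "0 < v \<and> v < u \<or> v = 0 \<and> u = 1 \<and> q = 1 \<or> v = 1 \<and> u = 1 \<and> p - q = 1"
  proof -
    consider "v = 0" | "v = u" | "0 < v" "v < u" using v by linarith
    then show ?thesis
    proof cases
      case 1
      then have qu: "\<bar>q * u\<bar> = 1" using norm det by simp
      have "u = 1" using qu pos by (metis abs_mult abs_of_pos abs_zmult_eq_1 mult.commute)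
      moreover have "0 < q" using wb 1 \<open>u = 1\<close> by (simp add: v_def q_def power2_eq_square)
      ultimately show ?thesis using 1 qu by simp
    next
      case 2
      then have qu: "\<bar>(p - q) * u\<bar> = 1" using norm det by (simp add: algebra_simps)
      have "u = 1" using qu pos by (metis abs_mult abs_of_pos abs_zmult_eq_1 mult.commute)
      moreover have "0 < p - q"
        using wb 2 \<open>u = 1\<close> by (simp add: v_def q_def power2_eq_square algebra_simps)
      ultimately show ?thesis using 2 qu by simp
    qed simp
  qed
  have eq: "x * (of_int u * (real (a 0) + x) + of_int v) = of_int p * (real (a 0) + x) + of_int q"
  proof -
    have "of_int u * (x * x) = of_int w" using w by (simp add: power2_eq_square)
    then show ?thesis by (simp add: rc v_def q_def algebra_simps)
  qed
  have "1 < real (a 0) + x" using c x(1) rc by linarith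
  then obtain k where k: "cf_matrix a k p q u v"
    "irrational_cf (real (a 0) + x) (\<lambda>i. a (i + Suc k))"
    using unimodular_imp_cf_matrix[OF cf _ eq _ inv pos(1)] norm det by auto
  moreover have "irrational_cf (real (a 0) + x) (a(0 := 2 * a 0))"
    using irrational_cf_add[OF cf, of "a 0"] by (simp add: mult_2)
  ultimately show ?thesis using irrational_cf_unique by blast
qed

section \<open>Minimal periods and the Pell equation\<close>

lemma irrational_cf_per_seq:
  assumes "per_expansion x m b" "x \<notin> \<rat>"
  shows "irrational_cf x (per_seq m b)"
proof -
  have "per_seq m b i \<ge> 1" for i
  proof -
    have "i mod (m + 1) \<le> m" by (simp add: less_Suc_eq_le[symmetric])
    then show ?thesis using assms(1) by (auto simp: per_seq_def per_expansion_def)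
  qed
  then show ?thesis using assms by (simp add: irrational_cf_def per_expansion_def)
qed

text \<open>Otherwise the nonzero remainder of k mod m + 1 would have the same shift property and
  yield an expansion with a shorter block.\<close>

lemma min_period_dvd:
  assumes min: "min_per_expansion x m b" and irr: "x \<notin> \<rat>"
    and shift: "(\<lambda>i. per_seq m b (i + k)) = (per_seq m b)(0 := 2 * b 0)"
  shows "(m + 1) dvd k"
proof (rule ccontr)
  assume "\<not> (m + 1) dvd k"
  then have "k mod (m + 1) \<noteq> 0" by (simp add: mod_eq_0_iff_dvd)
  then obtain d where d: "k mod (m + 1) = Suc d" by (cases "k mod (m + 1)") auto
  let ?a = "per_seq m b"
  have cf: "irrational_cf x ?a"
    using irrational_cf_per_seq min irr unfolding min_per_expansion_def by blast
  have a0: "?a 0 = b 0" by (simp add: per_seq_def)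
  have "(\<lambda>i. ?a (i + Suc d)) = ?a(0 := 2 * b 0)"
  proof -
    have "?a (i + k) = ?a (i + Suc d)" for i
    proof -
      have "(i + k) mod (m + 1) = (i + Suc d) mod (m + 1)"
        using mod_add_right_eq[of i k "m + 1"] unfolding d by simp
      moreover have "k \<noteq> 0" using d by (metis mod_0 nat.distinct(1))
      ultimately show ?thesis by (simp add: per_seq_def)
    qed
    then show ?thesis using shift by simp
  qed
  then have "per_seq d ?a = ?a" by (intro per_seq_eq_self) (simp only: a0)
  then have "per_expansion x d ?a"
    using cf by (simp add: per_expansion_def irrational_cf_def)
  then have "m \<le> d" using min unfolding min_per_expansion_def by blast
  moreover have "Suc d < m + 1" unfolding d[symmetric] by simp
  ultimately show False by simp
qed

text \<open>Here w = u D / Q is an integer, so coprimality gives u = t Q and w = t D, and the norm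
  equation becomes the Pell equation.\<close>

lemma period_end_pell:
  fixes D Q :: nat
  assumes "coprime D Q" and "Q \<ge> 1" and irr: "sqrt (real D / real Q) \<notin> \<rat>"
    and min: "min_per_expansion (sqrt (real D / real Q)) m b"
    and "l \<ge> 1"
  shows "\<exists>t>0. cf_den (per_seq m b) (l * (m + 1) - 1) = t * int Q \<and>
    0 < cf_num (per_seq m b) (l * (m + 1) - 1) \<and>
    \<bar>(cf_num (per_seq m b) (l * (m + 1) - 1))\<^sup>2 - int (D * Q) * t\<^sup>2\<bar> = 1"
proof -
  let ?x = "sqrt (real D / real Q)" and ?a = "per_seq m b" and ?k = "l * (m + 1) - 1"
  have cf: "irrational_cf ?x ?a"
    using irrational_cf_per_seq min irr unfolding min_per_expansion_def by blast
  then have a1: "\<And>i. ?a i \<ge> 1" by (simp add: irrational_cf_def)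
  have k: "Suc ?k = l * (m + 1)" using \<open>l \<ge> 1\<close> by simp
  have a0: "?a 0 = b 0" by (simp add: per_seq_def)
  have shift: "(\<lambda>i. ?a (i + Suc ?k)) = ?a(0 := 2 * ?a 0)"
    unfolding k a0 by (rule per_seq_shift[OF \<open>l \<ge> 1\<close>])
  obtain p q u v where M: "cf_matrix ?a ?k p q u v" using cf_matrix_exists by blast
  have pos: "0 < p" "0 < u" using cf_matrix_pos[OF M a1] by auto
  have x2: "?x\<^sup>2 = real D / real Q" by simp
  obtain w where w: "of_int u * ?x\<^sup>2 = of_int w" "\<bar>p\<^sup>2 - w * u\<bar> = 1"
    using period_end_imp_norm[OF cf shift _ M] unfolding x2 by auto
  have "of_int (u * int D) = (of_int (w * int Q) :: real)"
    using w(1) \<open>Q \<ge> 1\<close> unfolding x2 by (simp add: field_simps)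
  then have uD: "u * int D = w * int Q" by (simp only: of_int_eq_iff)
  then have "int Q dvd u * int D" by simp
  then have "int Q dvd u"
    using \<open>coprime D Q\<close> by (simp add: coprime_dvd_mult_left_iff coprime_commute)
  then obtain t where t: "u = t * int Q" by (metis dvd_def mult.commute)
  have "w = t * int D" using uD \<open>Q \<ge> 1\<close> unfolding t by (simp add: algebra_simps)
  then have "\<bar>p\<^sup>2 - int (D * Q) * t\<^sup>2\<bar> = 1" using w(2) t by (simp add: algebra_simps power2_eq_square)
  moreover have "0 < t" using pos(2) t \<open>Q \<ge> 1\<close> by (simp add: zero_less_mult_iff)
  ultimately show ?thesis using cf_matrix_num_den[OF M a1] t pos by auto
qed

lemma pell_period_end:
  fixes D Q :: nat and r t :: int
  assumes "Q \<ge> 1" and irr: "sqrt (real D / real Q) \<notin> \<rat>"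
    and min: "min_per_expansion (sqrt (real D / real Q)) m b"
    and "0 < r" "0 < t" and norm: "\<bar>r\<^sup>2 - int (D * Q) * t\<^sup>2\<bar> = 1"
  shows "\<exists>l\<ge>1. cf_num (per_seq m b) (l * (m + 1) - 1) = r"
proof -
  let ?x = "sqrt (real D / real Q)" and ?a = "per_seq m b"
  have cf: "irrational_cf ?x ?a"
    using irrational_cf_per_seq min irr unfolding min_per_expansion_def by blast
  then have a1: "\<And>i. ?a i \<ge> 1" by (simp add: irrational_cf_def)
  have a0: "?a 0 = b 0" by (simp add: per_seq_def)
  \<comment> \<open>The norm criterion is applied with u = t Q and w = t D.\<close>
  have "of_int (t * int Q) * ?x\<^sup>2 = of_int (t * int D)" using \<open>Q \<ge> 1\<close> by simp
  moreover have "0 < t * int Q" using \<open>0 < t\<close> \<open>Q \<ge> 1\<close> by simp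
  moreover have "\<bar>r\<^sup>2 - (t * int D) * (t * int Q)\<bar> = 1"
    using norm by (simp add: algebra_simps power2_eq_square)
  ultimately obtain k q v where k: "cf_matrix ?a k r q (t * int Q) v"
    "(\<lambda>i. ?a (i + Suc k)) = ?a(0 := 2 * b 0)"
    using norm_imp_period_end[OF cf \<open>0 < r\<close>] unfolding a0 by blast
  obtain l where l: "Suc k = l * (m + 1)"
    using min_period_dvd[OF min irr k(2)] by (metis dvd_def mult.commute)
  then have "l \<ge> 1" by (cases l) auto
  moreover have "k = l * (m + 1) - 1" using l by simp
  ultimately show ?thesis using cf_matrix_num_den(1)[OF k(1) a1] by blast
qed

section \<open>Comparison of the two enumerations\<close>

lemma strict_mono_period_end_num:
  assumes "irrational_cf x a"
  shows "strict_mono (\<lambda>l. cf_num a (Suc l * (m + 1) - 1))"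
proof -
  have "strict_mono (cf_num a)"
    using assms cf_num_den_mono by (simp add: strict_mono_Suc_iff irrational_cf_def)
  moreover have "strict_mono (\<lambda>l. Suc l * (m + 1) - 1)" by (simp add: strict_mono_Suc_iff)
  ultimately show ?thesis by (simp add: strict_mono_def)
qed

text \<open>Here f = g o h with h strictly increasing, so n \<le> h n. Used in both directions, it
  shows that equal ranges force equal enumerations.\<close>

lemma strict_mono_range_subset_le:
  fixes f g :: "nat \<Rightarrow> 'a::linorder"
  assumes "strict_mono f" "strict_mono g" "range f \<subseteq> range g"
  shows "g n \<le> f n"
proof -
  have "\<forall>i. \<exists>j. f i = g j" using assms(3) by blast
  then obtain h where h: "\<And>i. f i = g (h i)" by metis
  have "strict_mono h"
    using assms(1) unfolding strict_mono_def h by (simp add: strict_mono_less[OF assms(2)])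
  then have "n \<le> h n" by (rule strict_mono_imp_increasing)
  then show ?thesis using assms(2) by (simp add: h strict_mono_less_eq)
qed

text \<open>The two norms differ by at most 2, whereas distinct positive s and t have squares at
  least 3 apart.\<close>

lemma pell_snd_unique:
  fixes r s t N :: int
  assumes "0 < s" "0 < t" "0 < N" "\<bar>r\<^sup>2 - N * s\<^sup>2\<bar> = 1" "\<bar>r\<^sup>2 - N * t\<^sup>2\<bar> = 1"
  shows "s = t"
proof -
  have no: False if "0 < s" "s < t" "\<bar>r\<^sup>2 - N * s\<^sup>2\<bar> = 1" "\<bar>r\<^sup>2 - N * t\<^sup>2\<bar> = 1" for s t :: int
  proof -
    have "(s + 1)\<^sup>2 \<le> t\<^sup>2" using that by (intro power_mono) auto
    then have "3 \<le> t\<^sup>2 - s\<^sup>2" using that(1) by (simp add: power2_eq_square algebra_simps)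
    then have "1 * 3 \<le> N * (t\<^sup>2 - s\<^sup>2)" using \<open>0 < N\<close> by (intro mult_mono) auto
    then show False using that(3,4) by (simp add: algebra_simps)
  qed
  show ?thesis using no[of s t] no[of t s] assms by (metis linorder_less_linear)
qed

theorem corollary1:
  fixes D Q m n :: nat and b b' :: "nat \<Rightarrow> nat"
  assumes "D \<ge> 1" and "Q \<ge> 1"
    and "coprime D Q"
    and "real D / real Q > 1"
    and "\<not> (\<exists>q::rat. q ^ 2 = of_nat D / of_nat Q)"
    and "min_per_expansion (sqrt (real D / real Q)) m b"
    and "min_per_expansion (sqrt (real (D * Q))) n b'"
  shows "\<forall>l\<ge>1.
      cf_num (per_seq m b) (l * (m + 1) - 1) = cf_num (per_seq n b') (l * (n + 1) - 1) \<and>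
      cf_den (per_seq m b) (l * (m + 1) - 1) = cf_den (per_seq n b') (l * (n + 1) - 1) * int Q"
proof -
  \<comment> \<open>The division by \<open>real 1\<close> puts \<open>?y\<close> in the shape of the
    preceding lemmas, with D Q and 1 for D and Q.\<close>
  let ?x = "sqrt (real D / real Q)" and ?y = "sqrt (real (D * Q) / real 1)"
  have irrx: "?x \<notin> \<rat>"
  proof
    assume "?x \<in> \<rat>"
    then obtain q where q: "?x = real_of_rat q" by (auto elim: Rats_cases)
    have "real_of_rat (q\<^sup>2) = ?x\<^sup>2" by (simp add: q of_rat_power)
    also have "\<dots> = real_of_rat (of_nat D / of_nat Q)" by (simp add: of_rat_divide)
    finally show False using assms(5) by (simp only: of_rat_eq_iff) blast
  qed
  have irry: "?y \<notin> \<rat>"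
  proof
    assume "?y \<in> \<rat>"
    then have "?y / real Q \<in> \<rat>" by (intro Rats_divide Rats_of_nat)
    moreover have "?y / real Q = ?x"
      using \<open>Q \<ge> 1\<close> by (simp add: real_sqrt_mult real_sqrt_divide field_simps)
    ultimately show False using irrx by simp
  qed
  have miny: "min_per_expansion ?y n b'" using assms(7) by simp
  let ?f = "\<lambda>l. cf_num (per_seq m b) (Suc l * (m + 1) - 1)"
  let ?g = "\<lambda>l. cf_num (per_seq n b') (Suc l * (n + 1) - 1)"
  note X = period_end_pell[OF assms(3,2) irrx assms(6)]
  note Y = period_end_pell[OF _ _ irry miny, simplified]
  have f: "strict_mono ?f" and g: "strict_mono ?g"
    using assms(6) miny irrx irry irrational_cf_per_seq
    by (auto simp only: min_per_expansion_def intro!: strict_mono_period_end_num)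
  have "range ?f \<subseteq> range ?g"
  proof
    fix r assume "r \<in> range ?f"
    then obtain l where "r = ?f l" by blast
    then obtain t where "0 < t" "0 < r" "\<bar>r\<^sup>2 - int (D * Q) * t\<^sup>2\<bar> = 1"
      using X[of "Suc l"] by auto
    then obtain j where "j \<ge> 1" "cf_num (per_seq n b') (j * (n + 1) - 1) = r"
      using pell_period_end[OF _ irry miny, of r t] by auto
    then show "r \<in> range ?g" by (intro image_eqI[of _ _ "j - 1"]) auto
  qed
  moreover have "range ?g \<subseteq> range ?f"
  proof
    fix r assume "r \<in> range ?g"
    then obtain l where "r = ?g l" by blast
    then obtain t where "0 < t" "0 < r" "\<bar>r\<^sup>2 - int (D * Q) * t\<^sup>2\<bar> = 1"
      using Y[of "Suc l"] by auto
    then obtain j where "j \<ge> 1" "cf_num (per_seq m b) (j * (m + 1) - 1) = r"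
      using pell_period_end[OF assms(2) irrx assms(6), of r t] by auto
    then show "r \<in> range ?f" by (intro image_eqI[of _ _ "j - 1"]) auto
  qed
  ultimately have fg: "?f l = ?g l" for l
    using strict_mono_range_subset_le f g by (metis (no_types, lifting) order_antisym)
  show ?thesis
  proof (intro allI impI)
    fix l :: nat assume "l \<ge> 1"
    then have num: "cf_num (per_seq m b) (l * (m + 1) - 1) = cf_num (per_seq n b') (l * (n + 1) - 1)"
      using fg[of "l - 1"] by simp
    obtain t where t: "0 < t" "cf_den (per_seq m b) (l * (m + 1) - 1) = t * int Q"
      "\<bar>(cf_num (per_seq m b) (l * (m + 1) - 1))\<^sup>2 - int (D * Q) * t\<^sup>2\<bar> = 1"
      using X[OF \<open>l \<ge> 1\<close>] by blast
    let ?s = "cf_den (per_seq n b') (l * (n + 1) - 1)"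
    have s: "0 < ?s" "\<bar>(cf_num (per_seq n b') (l * (n + 1) - 1))\<^sup>2 - int (D * Q) * ?s\<^sup>2\<bar> = 1"
      using Y[of l] \<open>l \<ge> 1\<close> by auto
    have "0 < int (D * Q)" using assms(1,2) by simp
    then have "t = ?s" using pell_snd_unique t(1,3) s unfolding num by blast
    then show "cf_num (per_seq m b) (l * (m + 1) - 1) = cf_num (per_seq n b') (l * (n + 1) - 1) \<and>
      cf_den (per_seq m b) (l * (m + 1) - 1) = ?s * int Q"
      using num t(2) by simp
  qed
qed

end
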